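(* Let $f\in C^3(\mathbb{R}^d)$, $d\ge 2$, let $k\in\{0,\dots,d\}$, and let $\mathbf{x}^*$ be a strict index-$k$ critical point of $f$. Suppose there are $r_0>0$, $M>0$, $L\ge\mu>0$ such that, with $U=\{\mathbf{x}\in\mathbb{R}^d:\|\mathbf{x}-\mathbf{x}^*\|_2\le r_0\}$, one has $\|\nabla^2 f(\mathbf{x})-\nabla^2 f(\mathbf{y})\|_2\le M\|\mathbf{x}-\mathbf{y}\|_2$ for all $\mathbf{x},\mathbf{y}\in U$, and for every $\mathbf{x}\in U$ the eigenvalues $\lambda_1\le\cdots\le\lambda_d$ of $\nabla^2 f(\mathbf{x})$ satisfy $$-L\le\lambda_1\le\cdots\le\lambda_k\le-\mu<0<\mu\le\lambda_{k+1}\le\cdots\le\lambda_d\le L$$ (the inequalities on the negative, respectively positive, eigenvalues being omitted when $k=0$, respectively $k=d$). Let $0<\sigma_{\min}\le\sigma_j\le\sigma_{\max}$. Let $\mathbf{x}_j$ be the current iterate, with inexact reflection $\widetilde R_j$, inexact reflected Hessian $\widetilde B_j$ and subspace error $\delta_j$ as defined in the context, and suppose the computed step $\mathbf{s}_j\in\mathbb{R}^d$ satisfies $$\boldsymbol{\xi}_j=\widetilde R_j\nabla f(\mathbf{x}_j)+\widetilde B_j\mathbf{s}_j+\sigma_j\|\mathbf{s}_j\|_2\mathbf{s}_j,\qquad \|\boldsymbol{\xi}_j\|_2\le\eta_j\|\nabla f(\mathbf{x}_j)\|_2,$$ with $\eta_j\ge0$; set $\mathbf{x}_{j+1}=\mathbf{x}_j+\mathbf{s}_j$.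 Fix $\bar\eta\ge0$ and $\bar\delta\ge0$ with $\bar\delta\le\frac{\mu}{4L}$, and define $$K=\frac{2(1+\bar\eta)}{\mu},\quad \rho=\min\left\{r_0,\frac{\mu}{M}\right\},\quad r=\frac{\rho}{1+KL},$$ $$C_1=\frac{2L}{\mu}\max\{1,2LK\},\quad C_2=\frac2\mu\left(\sigma_{\max}+\frac M2\right)K^2L^2.$$ If $\delta_j\le\bar\delta$, $\eta_j\le\bar\eta$ and $\|\mathbf{x}_j-\mathbf{x}^*\|_2\le r$, then the whole line segment $\{\mathbf{x}_j+t\mathbf{s}_j:t\in[0,1]\}$ is contained in $U$, the approximate reflected Hessian satisfies $\widetilde B_j\succeq\frac\mu2\mathbf{I}$, and $$\|\mathbf{x}_{j+1}-\mathbf{x}^*\|_2\le C_1(\delta_j+\eta_j)\|\mathbf{x}_j-\mathbf{x}^*\|_2+C_2\|\mathbf{x}_j-\mathbf{x}^*\|_2^2.$$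
   Context: Standing assumption of the paper: $f\in C^3(\mathbb{R}^d)$ with $d\ge2$, having finitely many non-degenerate critical points. $\|\cdot\|_2$ is the Euclidean norm on vectors and the spectral norm on matrices; $\mathbf{I}$ is the identity matrix; $A\succeq B$ means $A-B$ is positive semidefinite. A strict index-$k$ critical point is a point $\mathbf{x}^*$ with $\nabla f(\mathbf{x}^* )=\mathbf{0}$ such that $\nabla^2 f(\mathbf{x}^* )$ is nonsingular with exactly $k$ negative eigenvalues (with multiplicity). Inexact quantities at $\mathbf{x}_j$: let $H_j=\nabla^2 f(\mathbf{x}_j)$ and let $P_j=\sum_{i=1}^k\mathbf{v}_i\mathbf{v}_i^\top$, where $\mathbf{v}_1,\dots,\mathbf{v}_k$ are orthonormal eigenvectors of $H_j$ associated with its $k$ smallest eigenvalues. Let $\widetilde V_j\in\mathbb{R}^{d\times k}$ be any matrix with orthonormal columns (the computed approximate eigenvectors), and set $$\widetilde P_j=\widetilde V_j\widetilde V_j^\top,\quad \widetilde R_j=\mathbf{I}-2\widetilde P_j,\quad \delta_j=\|\widetilde P_j-P_j\|_2,\quad \widetilde B_j=\tfrac12\left(\widetilde R_jH_j+H_j\widetilde R_j\right).$$ The step $\mathbf{s}_j$ is an approximate stationary point of the inexact cubic model $\mathbf{s}\mapsto f(\mathbf{x}_j)+(\widetilde R_j\nabla f(\mathbf{x}_j))^\top\mathbf{s}+\frac12\mathbf{s}^\top\widetilde B_j\mathbf{s}+\frac{\sigma_j}{3}\|\mathbf{s}\|_2^3$, in the sense of the residual condition in the claim. *)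

theory Defs
  imports "HOL-Analysis.Analysis" "HOL-Computational_Algebra.Polynomial"
    "HOL-Library.Multiset"
begin

text \<open>\<open>f\<close> is of class \<open>C\<^sup>m\<close> on the whole space: all iterated directional derivatives of order
  up to \<open>m\<close> exist (as values of Frechet derivatives) and are continuous.\<close>

fun C_class :: "nat \<Rightarrow> ('a::real_normed_vector \<Rightarrow> 'b::real_normed_vector) \<Rightarrow> bool" where
  "C_class 0 f \<longleftrightarrow> continuous_on UNIV f"
| "C_class (Suc m) f \<longleftrightarrow>
     (\<forall>x. f differentiable (at x)) \<and> (\<forall>v. C_class m (\<lambda>x. frechet_derivative f (at x) v))"

definition gradient :: "(real^'n \<Rightarrow> real) \<Rightarrow> real^'n \<Rightarrow> real^'n" where
  "gradient f x = (THE g. GDERIV f x :> g)"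

definition hessian :: "(real^'n \<Rightarrow> real) \<Rightarrow> real^'n \<Rightarrow> real^'n^'n" where
  "hessian f x = jacobian (gradient f) (at x)"

definition charpoly :: "real^'n^'n \<Rightarrow> real poly" where
  "charpoly A = det (mat [:0, 1:] - map_matrix (\<lambda>a. [:a:]) A)"

text \<open>Only the real eigenvalues are listed, with algebraic multiplicity; a symmetric \<open>n \<times> n\<close> matrix
  has exactly \<open>n\<close> of them.\<close>

definition eigenvalues :: "real^'n^'n \<Rightarrow> real multiset" where
  "eigenvalues A = proots (charpoly A)"

text \<open>The \<open>i\<close>-th smallest eigenvalue, counted from \<open>i = 1\<close>.\<close>

definition ordered_eigenvalue :: "real^'n^'n \<Rightarrow> nat \<Rightarrow> real" where
  "ordered_eigenvalue A i = sorted_list_of_multiset (eigenvalues A) ! (i - 1)"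

definition strict_critical_point :: "nat \<Rightarrow> (real^'n \<Rightarrow> real) \<Rightarrow> real^'n \<Rightarrow> bool" where
  "strict_critical_point k f x \<longleftrightarrow>
     gradient f x = 0 \<and> invertible (hessian f x) \<and>
     size (filter_mset (\<lambda>l. l < 0) (eigenvalues (hessian f x))) = k"

definition spectral_norm :: "real^'n^'n \<Rightarrow> real" where
  "spectral_norm A = onorm (\<lambda>v. A *v v)"

definition positive_semidefinite :: "real^'n^'n \<Rightarrow> bool" where
  "positive_semidefinite A \<longleftrightarrow> transpose A = A \<and> (\<forall>v. 0 \<le> v \<bullet> (A *v v))"

text \<open>Since \<open>k\<close> is a number rather than a type (and may be \<open>0\<close>), a matrix with \<open>k\<close> columns is
  represented by the family \<open>V 1, \<dots>, V k\<close> of its columns; values of \<open>V\<close> at other indices are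
  irrelevant.\<close>

definition orthonormal_columns :: "nat \<Rightarrow> (nat \<Rightarrow> real^'n) \<Rightarrow> bool" where
  "orthonormal_columns k V \<longleftrightarrow>
     (\<forall>i\<in>{1..k}. \<forall>j\<in>{1..k}. V i \<bullet> V j = (if i = j then 1 else 0))"

text \<open>The matrix \<open>V V\<^sup>T\<close>, as the sum of the outer products of the columns.\<close>

definition column_projector :: "nat \<Rightarrow> (nat \<Rightarrow> real^'n) \<Rightarrow> real^'n^'n" where
  "column_projector k V = (\<Sum>i=1..k. (columnvector (V i) :: real^1^'n) ** rowvector (V i))"

definition smallest_eigenvectors :: "nat \<Rightarrow> real^'n^'n \<Rightarrow> (nat \<Rightarrow> real^'n) \<Rightarrow> bool" where
  "smallest_eigenvectors k A v \<longleftrightarrow>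
     orthonormal_columns k v \<and> (\<forall>i\<in>{1..k}. A *v v i = ordered_eigenvalue A i *\<^sub>R v i)"

definition reflection :: "nat \<Rightarrow> (nat \<Rightarrow> real^'n) \<Rightarrow> real^'n^'n" where
  "reflection k V = mat 1 - 2 *\<^sub>R column_projector k V"

definition reflected_hessian :: "nat \<Rightarrow> (nat \<Rightarrow> real^'n) \<Rightarrow> real^'n^'n \<Rightarrow> real^'n^'n" where
  "reflected_hessian k V H = (1/2) *\<^sub>R (reflection k V ** H + H ** reflection k V)"

end

theory Submission
  imports Defs
begin

text \<open>The exact projector \<open>P\<close> commutes with \<open>H\<close>, and \<open>(I - 2P) H\<close> is \<open>|H| \<succeq> \<mu> I\<close>. Replacing \<open>P\<close> by
  \<open>P\<close> plus an error \<open>E\<close> of norm \<open>\<delta>\<close> changes the quadratic form by at most \<open>2 \<delta> L \<le> \<mu> / 2\<close>, which gives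
  the coercivity of the inexact reflected Hessian \<open>B\<close>. Testing the residual equation with \<open>s\<close> then
  bounds \<open>s\<close> by \<open>K L \<parallel>e\<parallel>\<close>, where \<open>e = x - x*\<close>, and so keeps the segment in \<open>U\<close>. For the rate, write
  \<open>B (e + s) = (B e - R H e) + R (H e - g) + \<xi> - \<sigma> \<parallel>s\<parallel> s\<close> with \<open>g\<close> the gradient and \<open>R\<close> the inexact
  reflection. Here \<open>B e - R H e = E H e - H E e\<close> is at most \<open>2 \<delta> L \<parallel>e\<parallel>\<close>, the second term is a Taylor
  remainder, and coercivity of \<open>B\<close> turns this into a bound on \<open>e + s\<close>.\<close>

section \<open>Gradient and Hessian of a twice continuously differentiable function\<close>

text \<open>Riesz representation: the derivative, expanded over \<open>Basis\<close>, is the inner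
  product with \<open>g\<close>. Existence and uniqueness of such a vector make the
  \<open>THE\<close> in \<open>gradient\<close> meaningful.\<close>

lemma frechet_derivative_eq_inner_gradient:
  fixes f :: "real^'n \<Rightarrow> real"
  assumes "f differentiable (at x)"
  shows "frechet_derivative f (at x) h = h \<bullet> gradient f x"
proof -
  define D where "D = frechet_derivative f (at x)"
  define g where "g = (\<Sum>b\<in>Basis. D b *\<^sub>R b)"
  have D: "(f has_derivative D) (at x)"
    using assms by (simp add: D_def frechet_derivative_works)
  then have lin: "linear D"
    by (rule has_derivative_linear)
  have Dg: "D h = h \<bullet> g" for h
    using Linear_Algebra.linear_componentwise[OF lin, of h 1]
    by (simp add: g_def inner_sum_right mult.commute)
  have "GDERIV f x :> g"
    using D by (simp add: gderiv_def Dg[abs_def])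
  moreover have "g' = g" if "GDERIV f x :> g'" for g'
  proof -
    have "(\<lambda>h. h \<bullet> g') = D"
      using has_derivative_unique D that unfolding gderiv_def by blast
    then have "h \<bullet> g' = h \<bullet> g" for h
      by (metis Dg)
    then show ?thesis
      using vector_eq_ldot by blast
  qed
  ultimately have "gradient f x = g"
    unfolding gradient_def by blast
  then show ?thesis
    using Dg D_def by simp
qed

section \<open>Symmetry of mixed second directional derivatives\<close>

lemma frechet_derivative_line:
  fixes f :: "'a::real_normed_vector \<Rightarrow> real"
  assumes "\<And>y. f differentiable (at y)"
  shows "((\<lambda>s. f (a + s *\<^sub>R u)) has_real_derivative
    frechet_derivative f (at (a + s *\<^sub>R u)) u) (at s)"
proof -
  have f: "(f has_derivative frechet_derivative f (at (a + s *\<^sub>R u))) (at (a + s *\<^sub>R u))"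
    using assms frechet_derivative_works by blast
  have "((\<lambda>s. a + s *\<^sub>R u) has_derivative (\<lambda>t. t *\<^sub>R u)) (at s)"
    by (auto intro!: derivative_eq_intros)
  from has_derivative_compose[OF this f]
  show ?thesis
    using linear_scale[OF has_derivative_linear[OF f]]
    by (simp add: has_field_derivative_def mult_commute_abs)
qed

text \<open>Two applications of the mean value theorem: first along \<open>u\<close> to the
  increment of \<open>f\<close> in direction \<open>h *\<^sub>R v\<close>, then along
  \<open>v\<close> to the resulting increment of the derivative in direction
  \<open>u\<close>.\<close>

lemma second_difference_mean_value:
  fixes f :: "'a::real_normed_vector \<Rightarrow> real"
  assumes "\<And>y. f differentiable (at y)"
    and "\<And>y. (\<lambda>z. frechet_derivative f (at z) u) differentiable (at y)"
    and "h > 0"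
  obtains s t where "0 < s" "s < h" "0 < t" "t < h"
    "f (x + h *\<^sub>R u + h *\<^sub>R v) - f (x + h *\<^sub>R u) - f (x + h *\<^sub>R v) + f x
      = h * h * frechet_derivative (\<lambda>z. frechet_derivative f (at z) u) (at (x + s *\<^sub>R u + t *\<^sub>R v)) v"
proof -
  let ?Du = "\<lambda>z. frechet_derivative f (at z) u"
  define \<phi> where "\<phi> s = f (x + h *\<^sub>R v + s *\<^sub>R u) - f (x + s *\<^sub>R u)" for s
  have "(\<phi> has_real_derivative ?Du (x + h *\<^sub>R v + s *\<^sub>R u) - ?Du (x + s *\<^sub>R u)) (at s)" for s
    unfolding \<phi>_def by (intro DERIV_diff frechet_derivative_line assms)
  from MVT2[OF assms(3) this] obtain s where s: "0 < s" "s < h"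
    "\<phi> h - \<phi> 0 = h * (?Du (x + h *\<^sub>R v + s *\<^sub>R u) - ?Du (x + s *\<^sub>R u))"
    by auto
  have "((\<lambda>t. ?Du (x + s *\<^sub>R u + t *\<^sub>R v)) has_real_derivative
      frechet_derivative ?Du (at (x + s *\<^sub>R u + t *\<^sub>R v)) v) (at t)" for t
    by (rule frechet_derivative_line[OF assms(2)])
  from MVT2[OF assms(3) this] obtain t where t: "0 < t" "t < h"
    "?Du (x + s *\<^sub>R u + h *\<^sub>R v) - ?Du (x + s *\<^sub>R u)
      = h * frechet_derivative ?Du (at (x + s *\<^sub>R u + t *\<^sub>R v)) v"
    by auto
  show ?thesis
    using s t by (intro that[of s t]) (simp_all add: \<phi>_def algebra_simps)
qed

text \<open>The second difference is symmetric in \<open>u\<close> and \<open>v\<close>, so both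
  orders of differentiation agree at two points that tend to \<open>x\<close> with the step size
  \<open>h n\<close>. Continuity carries the equality to \<open>x\<close>.\<close>

lemma frechet_derivative_commute:
  fixes f :: "'a::real_normed_vector \<Rightarrow> real"
  assumes "\<And>y. f differentiable (at y)"
    and "\<And>w y. (\<lambda>z. frechet_derivative f (at z) w) differentiable (at y)"
    and "\<And>w w' y. isCont (\<lambda>y. frechet_derivative (\<lambda>z. frechet_derivative f (at z) w) (at y) w') y"
  shows "frechet_derivative (\<lambda>z. frechet_derivative f (at z) u) (at x) v
    = frechet_derivative (\<lambda>z. frechet_derivative f (at z) v) (at x) u"
proof -
  let ?DD = "\<lambda>u v y. frechet_derivative (\<lambda>z. frechet_derivative f (at z) u) (at y) v"
  define h where "h n = inverse (real (Suc n))" for n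
  have h: "h n > 0" for n
    by (simp add: h_def)
  have h0: "h \<longlonglongrightarrow> 0"
    unfolding h_def using LIMSEQ_inverse_real_of_nat .
  have "\<exists>s t s' t'. 0 < s \<and> s < h n \<and> 0 < t \<and> t < h n \<and> 0 < s' \<and> s' < h n \<and> 0 < t' \<and> t' < h n
    \<and> ?DD u v (x + s *\<^sub>R u + t *\<^sub>R v) = ?DD v u (x + s' *\<^sub>R v + t' *\<^sub>R u)" for n
  proof -
    obtain s t where st: "0 < s" "s < h n" "0 < t" "t < h n"
      "f (x + h n *\<^sub>R u + h n *\<^sub>R v) - f (x + h n *\<^sub>R u) - f (x + h n *\<^sub>R v) + f x
        = h n * h n * ?DD u v (x + s *\<^sub>R u + t *\<^sub>R v)"
      using second_difference_mean_value[OF assms(1) assms(2) h] by blast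
    obtain s' t' where st': "0 < s'" "s' < h n" "0 < t'" "t' < h n"
      "f (x + h n *\<^sub>R v + h n *\<^sub>R u) - f (x + h n *\<^sub>R v) - f (x + h n *\<^sub>R u) + f x
        = h n * h n * ?DD v u (x + s' *\<^sub>R v + t' *\<^sub>R u)"
      using second_difference_mean_value[OF assms(1) assms(2) h] by blast
    have "h n * h n * ?DD u v (x + s *\<^sub>R u + t *\<^sub>R v) = h n * h n * ?DD v u (x + s' *\<^sub>R v + t' *\<^sub>R u)"
      unfolding st(5)[symmetric] st'(5)[symmetric] by (simp add: algebra_simps)
    then show ?thesis
      using st st' h[of n] by force
  qed
  then obtain s t s' t' where
    b: "\<And>n. 0 < s n \<and> s n < h n \<and> 0 < t n \<and> t n < h n \<and> 0 < s' n \<and> s' n < h n \<and> 0 < t' n \<and> t' n < h n"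
    and eq: "\<And>n. ?DD u v (x + s n *\<^sub>R u + t n *\<^sub>R v) = ?DD v u (x + s' n *\<^sub>R v + t' n *\<^sub>R u)"
    by metis
  have lim: "w \<longlonglongrightarrow> 0" if "\<And>n. 0 < w n \<and> w n < h n" for w :: "nat \<Rightarrow> real"
    using that by (intro tendsto_sandwich[OF _ _ tendsto_const h0]) (auto intro!: always_eventually less_imp_le)
  have lims: "s \<longlonglongrightarrow> 0" "t \<longlonglongrightarrow> 0" "s' \<longlonglongrightarrow> 0" "t' \<longlonglongrightarrow> 0"
    by (rule lim; use b in blast)+
  have "(\<lambda>n. x + s n *\<^sub>R u + t n *\<^sub>R v) \<longlonglongrightarrow> x + 0 *\<^sub>R u + 0 *\<^sub>R v"
    by (intro tendsto_intros lims)
  then have "(\<lambda>n. x + s n *\<^sub>R u + t n *\<^sub>R v) \<longlonglongrightarrow> x"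
    by simp
  then have l1: "(\<lambda>n. ?DD u v (x + s n *\<^sub>R u + t n *\<^sub>R v)) \<longlonglongrightarrow> ?DD u v x"
    by (rule isCont_tendsto_compose[OF assms(3)])
  have "(\<lambda>n. x + s' n *\<^sub>R v + t' n *\<^sub>R u) \<longlonglongrightarrow> x + 0 *\<^sub>R v + 0 *\<^sub>R u"
    by (intro tendsto_intros lims)
  then have "(\<lambda>n. x + s' n *\<^sub>R v + t' n *\<^sub>R u) \<longlonglongrightarrow> x"
    by simp
  then have l2: "(\<lambda>n. ?DD v u (x + s' n *\<^sub>R v + t' n *\<^sub>R u)) \<longlonglongrightarrow> ?DD v u x"
    by (rule isCont_tendsto_compose[OF assms(3)])
  show ?thesis
    using l1 l2 unfolding eq by (rule LIMSEQ_unique)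
qed

lemma C_class_imp_continuous_on: "C_class m f \<Longrightarrow> continuous_on UNIV f"
  by (cases m) (auto simp: differentiable_imp_continuous_within continuous_at_imp_continuous_on)

text \<open>\<open>C_class\<close> speaks of directional derivatives only; these are the components
  of \<open>gradient f\<close>, and componentwise differentiability suffices in finite dimension.
  Symmetry of the Hessian is then \<open>frechet_derivative_commute\<close> read through inner
  products.\<close>

lemma
  fixes f :: "real^'n \<Rightarrow> real"
  assumes "C_class (Suc (Suc m)) f"
  shows gradient_has_derivative_hessian: "(gradient f has_derivative (\<lambda>h. hessian f x *v h)) (at x)"
    and transpose_hessian: "transpose (hessian f x) = hessian f x"
proof -
  have 1: "\<And>y. f differentiable (at y)"
    and 2: "\<And>w y. (\<lambda>z. frechet_derivative f (at z) w) differentiable (at y)"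
    using assms by auto
  have 3: "isCont (\<lambda>y. frechet_derivative (\<lambda>z. frechet_derivative f (at z) w) (at y) w') y" for w w' y
    using assms C_class_imp_continuous_on continuous_on_eq_continuous_at open_UNIV by (metis C_class.simps(2) UNIV_I)
  have eq: "(\<lambda>z. frechet_derivative f (at z) w) = (\<lambda>z. gradient f z \<bullet> w)" for w
    by (simp add: frechet_derivative_eq_inner_gradient[OF 1] inner_commute)
  have "gradient f differentiable (at x)"
    using 2 unfolding eq by (simp add: differentiable_componentwise_within[of "gradient f"])
  then show G: "(gradient f has_derivative (\<lambda>h. hessian f x *v h)) (at x)"
    by (simp add: hessian_def jacobian_works)
  have "((\<lambda>z. gradient f z \<bullet> u) has_derivative (\<lambda>h. (hessian f x *v h) \<bullet> u)) (at x)" for u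
    by (intro has_derivative_inner_left G)
  then have "frechet_derivative (\<lambda>z. gradient f z \<bullet> u) (at x) v = (hessian f x *v v) \<bullet> u" for u v
    using frechet_derivative_at by metis
  then have "(hessian f x *v v) \<bullet> u = (hessian f x *v u) \<bullet> v" for u v
    using frechet_derivative_commute[OF 1 2 3, of u x v] unfolding eq by simp
  then have "(transpose (hessian f x) *v u) \<bullet> v = (hessian f x *v u) \<bullet> v" for u v
    by (metis dot_lmul_matrix inner_commute vector_transpose_matrix transpose_transpose transpose_matrix_vector)
  then show "transpose (hessian f x) = hessian f x"
    by (metis vector_eq_rdot matrix_eq)
qed

section \<open>Spectral decomposition of symmetric matrices\<close>

text \<open>At a maximiser \<open>x\<close> of the Rayleigh quotient on \<open>S\<close> with value \<open>m\<close>, the form \<open>m \<parallel>y\<parallel>\<^sup>2 - y \<bullet> T y\<close>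
  is nonnegative on \<open>S\<close> and vanishes at \<open>x\<close>; perturbing in the direction \<open>T x - m x\<close> forces
  this vector to be \<open>0\<close>.\<close>

lemma self_adjoint_eigenvector:
  fixes T :: "'a::euclidean_space \<Rightarrow> 'a"
  assumes "linear T" and sym: "\<And>x y. T x \<bullet> y = x \<bullet> T y"
    and S: "subspace S" and inv: "T ` S \<subseteq> S" and "S \<noteq> {0}"
  obtains x where "x \<in> S" "norm x = 1" "T x = (x \<bullet> T x) *\<^sub>R x"
proof -
  let ?C = "S \<inter> sphere 0 1"
  obtain z where z: "z \<in> S" "z \<noteq> 0"
    using \<open>S \<noteq> {0}\<close> subspace_0[OF S] by blast
  then have "z /\<^sub>R norm z \<in> ?C"
    by (simp add: subspace_scale[OF S])
  moreover have "compact ?C"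
    by (simp add: closed_Int_compact closed_subspace S)
  moreover have "continuous_on ?C (\<lambda>x. x \<bullet> T x)"
    by (intro continuous_intros linear_continuous_on linear_conv_bounded_linear[THEN iffD1] assms)
  ultimately obtain x where x: "x \<in> ?C" and max: "\<And>y. y \<in> ?C \<Longrightarrow> y \<bullet> T y \<le> x \<bullet> T x"
    using continuous_attains_sup[of ?C "\<lambda>x. x \<bullet> T x"] by blast
  define m where "m = x \<bullet> T x"
  have quad: "y \<bullet> T y \<le> m * (y \<bullet> y)" if "y \<in> S" for y
  proof (cases "y = 0")
    case False
    then have "y /\<^sub>R norm y \<in> ?C"
      using that by (simp add: subspace_scale[OF S])
    from max[OF this] have "(y \<bullet> T y) / (norm y)\<^sup>2 \<le> m"
      by (simp add: linear_scale[OF \<open>linear T\<close>] m_def power2_eq_square divide_inverse mult_ac)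
    with False show ?thesis
      by (simp add: pos_divide_le_eq dot_square_norm)
  qed (simp add: linear_0[OF \<open>linear T\<close>])
  define r where "r = T x - m *\<^sub>R x"
  have xS: "x \<in> S" and nx: "norm x = 1"
    using x by auto
  have rS: "r \<in> S"
    using xS inv by (auto simp: r_def intro!: subspace_diff[OF S] subspace_scale[OF S])
  define c where "c = m * (r \<bullet> r) - r \<bullet> T r"
  have "2 * t * (r \<bullet> r) \<le> t * t * c" for t
  proof -
    have "x + t *\<^sub>R r \<in> S"
      using xS rS by (intro subspace_add[OF S] subspace_scale[OF S])
    from quad[OF this] have "m + 2 * t * (r \<bullet> T x) + t * t * (r \<bullet> T r)
      \<le> m * (1 + 2 * t * (r \<bullet> x) + t * t * (r \<bullet> r))"
      using nx sym[of x r]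
      by (simp add: linear_add[OF \<open>linear T\<close>] linear_scale[OF \<open>linear T\<close>] inner_add m_def[symmetric]
          inner_commute norm_eq_1 algebra_simps)
    moreover have "r \<bullet> T x = r \<bullet> r + m * (r \<bullet> x)"
      by (simp add: r_def inner_diff inner_commute algebra_simps)
    ultimately show ?thesis
      by (simp add: c_def algebra_simps)
  qed
  note le = this
  have "r \<bullet> r = 0"
  proof (rule ccontr)
    assume "r \<bullet> r \<noteq> 0"
    then have pos: "r \<bullet> r > 0"
      by simp
    have "c > 0"
      using le[of 1] pos by linarith
    \<comment> \<open>For small \<open>t > 0\<close> the linear term outweighs the quadratic one;
      \<open>t = (r \<bullet> r) / c\<close> is already small enough for a contradiction.\<close>
    then have "2 * ((r \<bullet> r) * (r \<bullet> r)) \<le> (r \<bullet> r) * (r \<bullet> r)"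
      using le[of "(r \<bullet> r) / c"] by (simp add: field_simps)
    with pos show False
      by (simp add: not_le[symmetric])
  qed
  then show ?thesis
    using that[OF xS nx] by (simp add: r_def m_def)
qed

text \<open>Induction on the dimension of \<open>S\<close>: after a unit eigenvector
  \<open>x\<close> is split off, self-adjointness keeps the orthogonal complement of
  \<open>x\<close> in \<open>S\<close> invariant. Invariant subspaces are allowed because a partial
  eigenbasis is completed below on an orthogonal complement.\<close>

lemma self_adjoint_orthonormal_eigenbasis:
  fixes T :: "'a::euclidean_space \<Rightarrow> 'a"
  assumes "linear T" and sym: "\<And>x y. T x \<bullet> y = x \<bullet> T y"
    and "subspace S" and "T ` S \<subseteq> S"
  shows "\<exists>B. B \<subseteq> S \<and> pairwise orthogonal B \<and> (\<forall>b\<in>B. norm b = 1 \<and> T b = (b \<bullet> T b) *\<^sub>R b) \<and> span B = S"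
  using assms(3,4)
proof (induction "dim S" arbitrary: S rule: less_induct)
  case less
  show ?case
  proof (cases "S = {0}")
    case True
    then show ?thesis
      by (intro exI[of _ "{}"]) auto
  next
    case False
    obtain x where x: "x \<in> S" "norm x = 1" "T x = (x \<bullet> T x) *\<^sub>R x"
      using self_adjoint_eigenvector[OF assms(1,2) less.prems False] by blast
    define S' where "S' = S \<inter> {y. orthogonal x y}"
    have S': "subspace S'"
      unfolding S'_def by (intro subspace_inter less.prems subspace_orthogonal_to_vector)
    have inv: "T ` S' \<subseteq> S'"
    proof clarify
      fix y assume y: "y \<in> S'"
      have "x \<bullet> T y = (x \<bullet> T x) * (x \<bullet> y)"
        using sym[of x y] x(3) by (metis inner_scaleR_left)
      then show "T y \<in> S'"
        using y less.prems(2) by (auto simp: S'_def orthogonal_def)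
    qed
    have "x \<notin> S'"
      using x(2) by (auto simp: S'_def orthogonal_def)
    then have "S' \<subset> S"
      using x(1) by (auto simp: S'_def)
    then have "dim S' < dim S"
      using dim_psubset[of S' S] S' less.prems(1) by (metis span_eq_iff)
    from less.hyps[OF this S' inv] obtain B where B: "B \<subseteq> S'" "pairwise orthogonal B"
      "\<forall>b\<in>B. norm b = 1 \<and> T b = (b \<bullet> T b) *\<^sub>R b" "span B = S'"
      by blast
    have "pairwise orthogonal (insert x B)"
      using B(1,2) by (auto simp: pairwise_insert S'_def orthogonal_commute)
    moreover have "span (insert x B) = S"
    proof
      show "span (insert x B) \<subseteq> S"
        using B(1) x(1) less.prems(1) by (intro span_minimal) (auto simp: S'_def)
      show "S \<subseteq> span (insert x B)"
      proof
        fix y assume y: "y \<in> S"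
        have "y - (x \<bullet> y) *\<^sub>R x \<in> S'"
          using y x less.prems(1)
          by (auto simp: S'_def orthogonal_def inner_diff norm_eq_1 subspace_diff subspace_scale)
        then show "y \<in> span (insert x B)"
          unfolding span_insert B(4) by blast
      qed
    qed
    ultimately show ?thesis
      using B(1,3) x by (intro exI[of _ "insert x B"]) (auto simp: S'_def)
  qed
qed

section \<open>Eigenvalues with multiplicity from an orthonormal eigenbasis\<close>

lemma map_matrix_const_poly_mult:
  "map_matrix (\<lambda>a. [:a:]) (A ** B) = map_matrix (\<lambda>a. [:a:]) A ** map_matrix (\<lambda>a. [:a:]) (B :: real^'n^'m)"
  by (simp add: vec_eq_iff matrix_matrix_mult_def sum_to_poly mult.commute)

text \<open>The orthogonal matrix \<open>Q\<close> with columns from \<open>B\<close> conjugates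
  \<open>A\<close> to the diagonal matrix \<open>D\<close>, and similar matrices share the
  characteristic polynomial. Its linear factors, one per basis vector, give the
  multiplicities.\<close>

lemma eigenvalues_orthonormal_eigenbasis:
  fixes A :: "real^'n^'n"
  assumes "card B = CARD('n)" and orth: "pairwise orthogonal B"
    and eig: "\<And>b. b \<in> B \<Longrightarrow> norm b = 1 \<and> A *v b = \<nu> b *\<^sub>R b"
  shows "eigenvalues A = image_mset \<nu> (mset_set B)"
proof -
  let ?m = "map_matrix (\<lambda>a::real. [:a:])"
  have "finite B"
    using assms(1) by (metis card_ge_0_finite zero_less_card_finite)
  then obtain g :: "'n \<Rightarrow> real^'n" where g: "bij_betw g UNIV B"
    using assms(1) by (metis finite_same_card_bij finite_class.finite_UNIV)
  then have gB: "g i \<in> B" for i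
    by (auto simp: bij_betw_def)
  define Q :: "real^'n^'n" where "Q = (\<chi> i j. g j $ i)"
  define D :: "real^'n^'n" where "D = (\<chi> i j. if i = j then \<nu> (g i) else 0)"
  have "orthogonal (g i) (g j)" if "i \<noteq> j" for i j
    using that gB g orth unfolding pairwise_def bij_betw_def by (metis injD)
  then have QQ: "transpose Q ** Q = mat 1"
    using eig[OF gB]
    by (subst orthogonal_matrix[symmetric]) (auto simp: orthogonal_matrix_orthonormal_columns Q_def column_def)
  have AQ: "A ** Q = Q ** D"
  proof -
    have "(A ** Q) $ i $ j = (A *v g j) $ i" for i j
      by (simp add: Q_def matrix_matrix_mult_def matrix_vector_mult_def)
    moreover have "(Q ** D) $ i $ j = \<nu> (g j) * g j $ i" for i j
      by (simp add: Q_def D_def matrix_matrix_mult_def if_distrib mult.commute cong: if_cong)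
    ultimately show ?thesis
      using eig[OF gB] by (simp add: vec_eq_iff)
  qed
  let ?X = "mat [:0, 1:] :: real poly^'n^'n"
  have comm: "?X ** Z = Z ** ?X" for Z :: "real poly^'n^'n"
    by (simp add: vec_eq_iff matrix_matrix_mult_def mat_def if_distrib[of "\<lambda>x. x * _"] if_distrib[of "\<lambda>x. _ * x"]
        mult.commute cong: if_cong)
  have "(?X - ?m A) ** ?m Q = ?m Q ** (?X - ?m D)"
    using AQ comm[of "?m Q"] map_matrix_const_poly_mult[of A Q] map_matrix_const_poly_mult[of Q D]
    by (simp add: vec_eq_iff matrix_matrix_mult_def algebra_simps sum_subtractf)
  then have "charpoly A * det (?m Q) = det (?m Q) * charpoly D"
    unfolding charpoly_def by (metis det_mul)
  \<comment> \<open>The factor \<open>det (?m Q)\<close> is to be cancelled in an integral domain;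
    orthogonality of \<open>Q\<close>, carried over to constant polynomials, makes its square equal
    to 1.\<close>
  moreover have "det (?m Q) \<noteq> 0"
  proof -
    have "transpose (?m Q) ** ?m Q = ?m (mat 1)"
      unfolding QQ[symmetric] map_matrix_const_poly_mult
      by (simp add: vec_eq_iff transpose_def matrix_matrix_mult_def)
    also have "\<dots> = mat 1"
      by (simp add: vec_eq_iff mat_def one_pCons)
    finally have "det (transpose (?m Q)) * det (?m Q) = 1"
      by (metis det_mul det_I)
    then show ?thesis
      by auto
  qed
  ultimately have "charpoly A = charpoly D"
    by (simp add: mult.commute)
  also have "\<dots> = (\<Prod>i\<in>UNIV. [:- \<nu> (g i), 1:])"
    unfolding charpoly_def by (subst det_diagonal) (auto simp: D_def mat_def)
  also have "\<dots> = (\<Prod>b\<in>B. [:- \<nu> b, 1:])"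
    by (rule prod.reindex_bij_betw[OF g])
  finally have "eigenvalues A = (\<Sum>b\<in>B. {#\<nu> b#})"
    unfolding eigenvalues_def by (simp add: proots_prod)
  also have "\<dots> = image_mset \<nu> (mset_set B)"
    using \<open>finite B\<close> by (induction B rule: finite_induct) auto
  finally show ?thesis .
qed

lemma symmetric_inner:
  fixes A :: "real^'n^'n"
  assumes "transpose A = A"
  shows "(A *v x) \<bullet> y = x \<bullet> (A *v y)"
  by (metis assms dot_lmul_matrix transpose_matrix_vector)

text \<open>\<open>A\<close> leaves the orthogonal complement of \<open>span B0\<close> invariant,
  so that complement has its own orthonormal eigenbasis \<open>W\<close>. Eigenvalues are written as
  Rayleigh quotients \<open>b \<bullet> (A *v b)\<close>, which gives one formula for old and new
  vectors.\<close>

lemma symmetric_eigenbasis_extension: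
  fixes A :: "real^'n^'n" and B0 :: "(real^'n) set"
  assumes "transpose A = A"
    and orth: "pairwise orthogonal B0"
    and eig: "\<And>b. b \<in> B0 \<Longrightarrow> norm b = 1 \<and> A *v b = (b \<bullet> (A *v b)) *\<^sub>R b"
  obtains W where "B0 \<inter> W = {}" "pairwise orthogonal (B0 \<union> W)" "card (B0 \<union> W) = CARD('n)"
    "span (B0 \<union> W) = UNIV"
    "\<And>b. b \<in> B0 \<union> W \<Longrightarrow> norm b = 1 \<and> A *v b = (b \<bullet> (A *v b)) *\<^sub>R b"
proof -
  let ?S = "(span B0)\<^sup>\<bottom>"
  have "(*v) A ` ?S \<subseteq> ?S"
  proof clarify
    fix y assume y: "y \<in> ?S"
    have "orthogonal (A *v y) b" if b: "b \<in> B0" for b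
    proof -
      have "(A *v y) \<bullet> b = (b \<bullet> (A *v b)) * (y \<bullet> b)"
        using eig[OF b] symmetric_inner[OF assms(1), of y b] by (metis inner_scaleR_right)
      moreover have "y \<bullet> b = 0"
        using y span_base[OF b] by (auto simp: orthogonal_comp_def orthogonal_def inner_commute)
      ultimately show ?thesis
        by (simp add: orthogonal_def)
    qed
    then show "A *v y \<in> ?S"
      unfolding orthogonal_comp_def using orthogonal_to_span orthogonal_commute by blast
  qed
  from self_adjoint_orthonormal_eigenbasis[OF matrix_vector_mul_linear symmetric_inner[OF assms(1)]
      subspace_orthogonal_comp this]
  obtain W where W: "W \<subseteq> ?S" "pairwise orthogonal W"
    "\<forall>b\<in>W. norm b = 1 \<and> A *v b = (b \<bullet> (A *v b)) *\<^sub>R b" "span W = ?S"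
    by blast
  have 0: "orthogonal b w" if "b \<in> B0" "w \<in> W" for b w
    using that W(1) span_base unfolding orthogonal_comp_def by blast
  have unit: "norm b = 1 \<and> A *v b = (b \<bullet> (A *v b)) *\<^sub>R b" if "b \<in> B0 \<union> W" for b
    using that W(3) eig by blast
  have disj: "B0 \<inter> W = {}"
    using 0 unit by (metis disjoint_iff UnI1 norm_zero orthogonal_self zero_neq_one)
  have po: "pairwise orthogonal (B0 \<union> W)"
    using orth W(2) 0 unfolding pairwise_def by (metis UnE orthogonal_commute)
  have "span (B0 \<union> W) = UNIV"
    using subspace_sum_orthogonal_comp[OF subspace_span, of B0]
    by (simp add: span_Un W(4)[symmetric] set_plus_def) blast
  moreover have "independent (B0 \<union> W)"
    using po unit by (intro pairwise_orthogonal_independent) force+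
  ultimately have "card (B0 \<union> W) = CARD('n)"
    by (metis DIM_cart DIM_real dim_UNIV indep_card_eq_dim_span mult.right_neutral)
  then show ?thesis
    using that disj po \<open>span (B0 \<union> W) = UNIV\<close> unit by blast
qed

text \<open>The ordered eigenvalues on the complement are identified by cancelling the first \<open>k\<close> entries
  of the sorted list of eigenvalues against \<open>v 1, \<dots>, v k\<close>.\<close>

lemma smallest_eigenvectors_extension:
  fixes A :: "real^'n^'n"
  assumes sym: "transpose A = A" and k: "k \<le> CARD('n)" and v: "smallest_eigenvectors k A v"
  obtains W where "v ` {1..k} \<inter> W = {}" "pairwise orthogonal (v ` {1..k} \<union> W)"
    "span (v ` {1..k} \<union> W) = UNIV"
    "\<And>b. b \<in> v ` {1..k} \<union> W \<Longrightarrow> norm b = 1 \<and> A *v b = (b \<bullet> (A *v b)) *\<^sub>R b"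
    "\<And>i. i \<in> {1..k} \<Longrightarrow> v i \<bullet> (A *v v i) = ordered_eigenvalue A i"
    "\<And>w. w \<in> W \<Longrightarrow> \<exists>i\<in>{k+1..CARD('n)}. w \<bullet> (A *v w) = ordered_eigenvalue A i"
proof -
  let ?\<nu> = "\<lambda>b. b \<bullet> (A *v b)"
  let ?l = "sorted_list_of_multiset (eigenvalues A)"
  have on: "v i \<bullet> v j = (if i = j then 1 else 0)" if "i \<in> {1..k}" "j \<in> {1..k}" for i j
    using v that by (auto simp: smallest_eigenvectors_def orthonormal_columns_def)
  have Av: "A *v v i = ordered_eigenvalue A i *\<^sub>R v i" if "i \<in> {1..k}" for i
    using v that by (auto simp: smallest_eigenvectors_def)
  have \<nu>v: "?\<nu> (v i) = ordered_eigenvalue A i" if "i \<in> {1..k}" for i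
    using on[OF that that] by (simp add: Av[OF that])
  have inj: "inj_on v {1..k}"
    using on by (metis inj_onI zero_neq_one)
  have po: "pairwise orthogonal (v ` {1..k})"
    using on by (auto simp: pairwise_def orthogonal_def)
  have eig: "norm b = 1 \<and> A *v b = ?\<nu> b *\<^sub>R b" if "b \<in> v ` {1..k}" for b
    using that on Av \<nu>v by (auto simp: norm_eq_1)
  obtain W where W: "v ` {1..k} \<inter> W = {}" "pairwise orthogonal (v ` {1..k} \<union> W)"
    "card (v ` {1..k} \<union> W) = CARD('n)" "span (v ` {1..k} \<union> W) = UNIV"
    "\<And>b. b \<in> v ` {1..k} \<union> W \<Longrightarrow> norm b = 1 \<and> A *v b = ?\<nu> b *\<^sub>R b"
    by (rule symmetric_eigenbasis_extension[OF sym po eig]) (assumption | rule that)+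
  have fin: "finite (v ` {1..k} \<union> W)"
    using W(3) by (metis card_ge_0_finite zero_less_card_finite)
  then have finW: "finite W"
    by simp
  have ev0: "eigenvalues A = image_mset ?\<nu> (mset_set (v ` {1..k} \<union> W))"
    using eigenvalues_orthonormal_eigenbasis[OF W(3,2,5)] .
  also have "image_mset ?\<nu> (mset_set (v ` {1..k} \<union> W)) = image_mset ?\<nu> (mset_set (v ` {1..k})) + image_mset ?\<nu> (mset_set W)"
    using W(1) finW by (simp add: mset_set_Union)
  also have "image_mset ?\<nu> (mset_set (v ` {1..k})) = image_mset (\<lambda>i. ordered_eigenvalue A i) (mset_set {1..k})"
    unfolding image_mset_mset_set[OF inj, symmetric] multiset.map_comp
    using \<nu>v by (intro image_mset_cong) simp
  also have "\<dots> = mset (map (\<lambda>i. ?l ! i) [0..<k])"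
  proof -
    \<comment> \<open>\<open>ordered_eigenvalue\<close> counts from 1, list positions from
      0.\<close>
    have "mset_set {1..k} = image_mset Suc (mset_set {0..<k})"
      by (subst image_mset_mset_set) (auto simp: image_Suc_atLeastLessThan atLeastLessThanSuc_atLeastAtMost)
    then show ?thesis
      by (simp add: multiset.map_comp o_def ordered_eigenvalue_def)
  qed
  finally have ev: "eigenvalues A = mset (map (\<lambda>i. ?l ! i) [0..<k]) + image_mset ?\<nu> (mset_set W)" .
  \<comment> \<open>\<open>eigenvalues\<close> lists real roots only; the eigenbasis shows that
    there are as many as the dimension, so positions up to \<open>CARD('n) - 1\<close> exist in
    \<open>?l\<close>.\<close>
  have "size (eigenvalues A) = CARD('n)"
    unfolding ev0 using W(3) by simp
  then have len: "length ?l = CARD('n)"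
    using size_mset[of ?l] by simp
  have "eigenvalues A = mset (take k ?l) + mset (drop k ?l)"
    by (metis append_take_drop_id mset_append mset_sorted_list_of_multiset)
  moreover have "take k ?l = map (\<lambda>i. ?l ! i) [0..<k]"
    using k len by (intro nth_equalityI) auto
  ultimately have Wl: "image_mset ?\<nu> (mset_set W) = mset (drop k ?l)"
    using ev by (metis add_left_cancel)
  have "\<exists>i\<in>{k+1..CARD('n)}. ?\<nu> w = ordered_eigenvalue A i" if "w \<in> W" for w
  proof -
    have "?\<nu> w \<in># image_mset ?\<nu> (mset_set W)"
      using that finW by simp
    then have "?\<nu> w \<in> set (drop k ?l)"
      unfolding Wl by simp
    then obtain j where "j < CARD('n) - k" "?\<nu> w = ?l ! (k + j)"
      using len k by (auto simp: in_set_conv_nth)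
    then show ?thesis
      by (intro bexI[of _ "k + j + 1"]) (auto simp: ordered_eigenvalue_def)
  qed
  then show ?thesis
    using that[OF W(1,2,4,5) \<nu>v] by blast
qed

text \<open>Parseval's identity, which reduces the estimates on quadratic forms and norms below to
  one coefficient at a time.\<close>

lemma inner_orthonormal_expand:
  fixes x y :: "'a::euclidean_space"
  assumes "pairwise orthogonal B" and "\<And>b. b \<in> B \<Longrightarrow> norm b = 1" and "span B = UNIV"
  shows "x \<bullet> y = (\<Sum>b\<in>B. (x \<bullet> b) * (y \<bullet> b))"
proof -
  have fin: "finite B"
    using assms(1) by (rule pairwise_orthogonal_imp_finite)
  have "(\<Sum>b\<in>B. (x \<bullet> b) *\<^sub>R b) = x"
    using assms fin by (intro orthonormal_basis_expand) auto
  then have "x \<bullet> y = (\<Sum>b\<in>B. (x \<bullet> b) *\<^sub>R b) \<bullet> y"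
    by simp
  also have "\<dots> = (\<Sum>b\<in>B. (x \<bullet> b) * (y \<bullet> b))"
    by (simp add: inner_sum_left inner_commute[of y])
  finally show ?thesis .
qed

lemma norm_mult_vec_le_eigenbasis:
  fixes A :: "real^'n^'n"
  assumes sym: "transpose A = A" and B: "pairwise orthogonal B" "span B = UNIV"
    and eig: "\<And>b. b \<in> B \<Longrightarrow> norm b = 1 \<and> A *v b = \<nu> b *\<^sub>R b"
    and le: "\<And>b. b \<in> B \<Longrightarrow> \<bar>\<nu> b\<bar> \<le> L" and "0 \<le> L"
  shows "norm (A *v y) \<le> L * norm y"
proof -
  have P: "x \<bullet> y = (\<Sum>b\<in>B. (x \<bullet> b) * (y \<bullet> b))" for x y :: "real^'n"
    using inner_orthonormal_expand[OF B(1) _ B(2)] eig by blast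
  have Ab: "(A *v y) \<bullet> b = \<nu> b * (y \<bullet> b)" if "b \<in> B" for b
    using symmetric_inner[OF sym, of y b] eig[OF that] by simp
  have "(norm (A *v y))\<^sup>2 = (\<Sum>b\<in>B. (\<nu> b)\<^sup>2 * (y \<bullet> b)\<^sup>2)"
    unfolding power2_norm_eq_inner
    by (subst P, intro sum.cong) (simp_all add: Ab power2_eq_square)
  also have "\<dots> \<le> (\<Sum>b\<in>B. L\<^sup>2 * (y \<bullet> b)\<^sup>2)"
    using le \<open>0 \<le> L\<close> by (intro sum_mono mult_right_mono) (auto simp: abs_le_square_iff[symmetric])
  also have "\<dots> = (L * norm y)\<^sup>2"
    unfolding power_mult_distrib power2_norm_eq_inner
    by (subst P) (simp add: sum_distrib_left power2_eq_square)
  finally show ?thesis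
    by (rule power2_le_imp_le) (simp add: \<open>0 \<le> L\<close>)
qed

lemma norm_mult_vec_le_ordered_eigenvalues:
  fixes A :: "real^'n^'n"
  assumes sym: "transpose A = A" and "0 \<le> L"
    and le: "\<And>i. i \<in> {1..CARD('n)} \<Longrightarrow> \<bar>ordered_eigenvalue A i\<bar> \<le> L"
  shows "norm (A *v y) \<le> L * norm y"
proof -
  \<comment> \<open>With \<open>k = 0\<close> no column is prescribed, so the zero family serves,
    and the extension \<open>W\<close> is a full eigenbasis whose eigenvalues are all ordered
    eigenvalues.\<close>
  let ?v = "\<lambda>_ :: nat. 0 :: real^'n"
  have v: "smallest_eigenvectors 0 A ?v"
    by (simp add: smallest_eigenvectors_def orthonormal_columns_def)
  show ?thesis
  proof (rule smallest_eigenvectors_extension[OF sym _ v])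
    fix W
    assume W: "pairwise orthogonal (?v ` {1..0} \<union> W)" "span (?v ` {1..0} \<union> W) = UNIV"
      "\<And>b. b \<in> ?v ` {1..0} \<union> W \<Longrightarrow> norm b = 1 \<and> A *v b = (b \<bullet> (A *v b)) *\<^sub>R b"
      "\<And>w. w \<in> W \<Longrightarrow> \<exists>i\<in>{0+1..CARD('n)}. w \<bullet> (A *v w) = ordered_eigenvalue A i"
    show ?thesis
      by (rule norm_mult_vec_le_eigenbasis[OF sym W(1,2,3)]) (use W(4) le \<open>0 \<le> L\<close> in force)+
  qed simp
qed

section \<open>Reflections\<close>

lemma column_projector_mult_vec:
  "column_projector k V *v y = (\<Sum>i=1..k. (V i \<bullet> y) *\<^sub>R V i)"
proof -
  have *: "((columnvector w :: real^1^'n) ** rowvector w) *v y = (w \<bullet> y) *\<^sub>R w" for w y :: "real^'n"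
    by (simp add: vec_eq_iff matrix_matrix_mult_def matrix_vector_mult_def columnvector_def rowvector_def
        inner_vec_def sum_distrib_left mult_ac)
  show ?thesis
    unfolding column_projector_def by (induction k) (auto simp: * matrix_vector_mult_add_rdistrib)
qed

lemma transpose_column_projector: "transpose (column_projector k V) = column_projector k V"
proof -
  have "x \<bullet> (transpose (column_projector k V) *v y) = x \<bullet> (column_projector k V *v y)" for x y
  proof -
    have "x \<bullet> (transpose (column_projector k V) *v y) = (column_projector k V *v x) \<bullet> y"
      by (metis dot_lmul_matrix inner_commute transpose_matrix_vector)
    then show ?thesis
      by (simp add: column_projector_mult_vec inner_sum_left inner_sum_right inner_commute mult.commute)
  qed
  then show ?thesis
    by (metis vector_eq_ldot matrix_eq)
qed

lemma transpose_reflection: "transpose (reflection k V) = reflection k V"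
  using transpose_column_projector[of k V]
  by (auto simp: reflection_def transpose_def vec_eq_iff mat_def)

lemma column_projector_idempotent:
  assumes "orthonormal_columns k V"
  shows "column_projector k V *v (column_projector k V *v y) = column_projector k V *v y"
proof -
  have "V i \<bullet> (\<Sum>j=1..k. (V j \<bullet> y) *\<^sub>R V j) = V i \<bullet> y" if "i \<in> {1..k}" for i
  proof -
    have "V i \<bullet> (\<Sum>j=1..k. (V j \<bullet> y) *\<^sub>R V j) = (\<Sum>j=1..k. if i = j then V j \<bullet> y else 0)"
      using assms that unfolding inner_sum_right
      by (intro sum.cong) (auto simp: orthonormal_columns_def)
    with that show ?thesis
      by simp
  qed
  then show ?thesis
    by (simp add: column_projector_mult_vec)
qed

lemma reflection_mult_vec: "reflection k V *v y = y - 2 *\<^sub>R (column_projector k V *v y)"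
  by (simp add: reflection_def matrix_vector_mult_diff_rdistrib scaleR_matrix_vector_assoc)

text \<open>For an orthogonal projection \<open>?p\<close> of \<open>y\<close> one has
  \<open>?p \<bullet> ?p = y \<bullet> ?p\<close>, so the terms with \<open>?p\<close> in the
  squared norm of \<open>y - 2 *\<^sub>R ?p\<close> cancel.\<close>

lemma norm_reflection:
  assumes "orthonormal_columns k V"
  shows "norm (reflection k V *v y) = norm y"
proof -
  let ?p = "column_projector k V *v y"
  have "?p \<bullet> ?p = y \<bullet> ?p"
    using column_projector_idempotent[OF assms, of y] symmetric_inner[OF transpose_column_projector]
    by metis
  then have "(reflection k V *v y) \<bullet> (reflection k V *v y) = y \<bullet> y"
    by (simp add: reflection_mult_vec inner_diff inner_commute)
  then show ?thesis
    by (simp add: norm_eq)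
qed

text \<open>On the eigenbasis the reflection is -1 on each \<open>v i\<close> and +1 on
  \<open>W\<close>. It thus flips exactly the eigenvalues bounded by \<open>- \<mu>\<close>, and
  every coefficient in Parseval's identity gains a factor of at least \<open>\<mu>\<close>.\<close>

lemma reflection_coercive:
  fixes A :: "real^'n^'n"
  assumes sym: "transpose A = A" and k: "k \<le> CARD('n)" and v: "smallest_eigenvectors k A v"
    and neg: "\<And>i. i \<in> {1..k} \<Longrightarrow> ordered_eigenvalue A i \<le> - \<mu>"
    and pos: "\<And>i. i \<in> {k+1..CARD('n)} \<Longrightarrow> \<mu> \<le> ordered_eigenvalue A i"
  shows "\<mu> * (y \<bullet> y) \<le> (reflection k v *v y) \<bullet> (A *v y)"
proof -
  let ?\<nu> = "\<lambda>b. b \<bullet> (A *v b)" and ?R = "reflection k v"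
  obtain W where W: "v ` {1..k} \<inter> W = {}" "pairwise orthogonal (v ` {1..k} \<union> W)"
    "span (v ` {1..k} \<union> W) = UNIV"
    "\<And>b. b \<in> v ` {1..k} \<union> W \<Longrightarrow> norm b = 1 \<and> A *v b = ?\<nu> b *\<^sub>R b"
    "\<And>i. i \<in> {1..k} \<Longrightarrow> ?\<nu> (v i) = ordered_eigenvalue A i"
    "\<And>w. w \<in> W \<Longrightarrow> \<exists>i\<in>{k+1..CARD('n)}. ?\<nu> w = ordered_eigenvalue A i"
    by (rule smallest_eigenvectors_extension[OF sym k v]) (assumption | rule that)+
  let ?B = "v ` {1..k} \<union> W"
  have P: "x \<bullet> y = (\<Sum>b\<in>?B. (x \<bullet> b) * (y \<bullet> b))" for x y :: "real^'n"
    using inner_orthonormal_expand[OF W(2) _ W(3)] W(4) by blast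
  have Ab: "(A *v y) \<bullet> b = ?\<nu> b * (y \<bullet> b)" if "b \<in> ?B" for b
    using symmetric_inner[OF sym, of y b] W(4)[OF that] by (metis inner_scaleR_right)
  have Rb: "(?R *v y) \<bullet> b = y \<bullet> (?R *v b)" for b
    by (rule symmetric_inner[OF transpose_reflection])
  have "\<mu> * ((y \<bullet> b) * (y \<bullet> b)) \<le> ((?R *v y) \<bullet> b) * ((A *v y) \<bullet> b)" if "b \<in> ?B" for b
    using that
  proof
    assume "b \<in> v ` {1..k}"
    then obtain i where i: "i \<in> {1..k}" "b = v i"
      by blast
    have "column_projector k v *v b = (\<Sum>j=1..k. if i = j then v j else 0)"
      unfolding column_projector_mult_vec using v i
      by (intro sum.cong) (auto simp: smallest_eigenvectors_def orthonormal_columns_def)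
    then have "?R *v b = - b"
      using i by (simp add: reflection_mult_vec scaleR_2)
    moreover have "?\<nu> b \<le> - \<mu>"
      using W(5)[OF i(1)] neg[OF i(1)] i(2) by simp
    then have "\<mu> * ((y \<bullet> b) * (y \<bullet> b)) \<le> - ?\<nu> b * ((y \<bullet> b) * (y \<bullet> b))"
      by (intro mult_right_mono) auto
    ultimately show ?thesis
      by (simp add: Rb Ab[OF that] mult_ac)
  next
    assume w: "b \<in> W"
    have "v j \<bullet> b = 0" if "j \<in> {1..k}" for j
    proof -
      have "v j \<noteq> b"
        using W(1) w that by blast
      then have "orthogonal (v j) b"
        using w that by (intro pairwiseD[OF W(2)]) auto
      then show ?thesis
        by (simp add: orthogonal_def)
    qed
    then have "?R *v b = b"
      by (simp add: reflection_mult_vec column_projector_mult_vec)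
    moreover have "\<mu> \<le> ?\<nu> b"
      using W(6)[OF w] pos by force
    then have "\<mu> * ((y \<bullet> b) * (y \<bullet> b)) \<le> ?\<nu> b * ((y \<bullet> b) * (y \<bullet> b))"
      by (intro mult_right_mono) auto
    ultimately show ?thesis
      by (simp add: Rb Ab[OF that] mult_ac)
  qed
  then have "(\<Sum>b\<in>?B. \<mu> * ((y \<bullet> b) * (y \<bullet> b))) \<le> (\<Sum>b\<in>?B. ((?R *v y) \<bullet> b) * ((A *v y) \<bullet> b))"
    by (rule sum_mono)
  then show ?thesis
    unfolding P[of y y] P[of "?R *v y" "A *v y"] sum_distrib_left .
qed

lemma column_projector_commute:
  fixes A :: "real^'n^'n"
  assumes sym: "transpose A = A" and v: "smallest_eigenvectors k A v"
  shows "A *v (column_projector k v *v y) = column_projector k v *v (A *v y)"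
proof -
  have Av: "A *v v i = ordered_eigenvalue A i *\<^sub>R v i" if "i \<in> {1..k}" for i
    using v that by (auto simp: smallest_eigenvectors_def)
  have "A *v (column_projector k v *v y) = (\<Sum>i=1..k. (v i \<bullet> y) *\<^sub>R (A *v v i))"
    by (simp add: column_projector_mult_vec linear_sum[OF matrix_vector_mul_linear] matrix_vector_mult_scaleR)
  also have "\<dots> = (\<Sum>i=1..k. (v i \<bullet> (A *v y)) *\<^sub>R v i)"
    using Av by (intro sum.cong) (auto simp: symmetric_inner[OF sym, symmetric])
  finally show ?thesis
    by (simp add: column_projector_mult_vec)
qed

section \<open>Perturbation bounds for the inexact reflected Hessian\<close>

lemma norm_mult_vec_le_spectral_norm: "norm (A *v y) \<le> spectral_norm A * norm y"
  unfolding spectral_norm_def by (rule onorm[OF matrix_vector_mul_bounded_linear])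

lemma reflected_hessian_mult_vec:
  "reflected_hessian k V A *v y
    = (1/2) *\<^sub>R (reflection k V *v (A *v y) + A *v (reflection k V *v y))"
  by (simp add: reflected_hessian_def scaleR_matrix_vector_assoc[symmetric] matrix_vector_mult_add_rdistrib
      matrix_vector_mul_assoc)

text \<open>Both factors are symmetric, so transposition exchanges the two products in the
  sum.\<close>

lemma transpose_reflected_hessian:
  assumes "transpose A = A"
  shows "transpose (reflected_hessian k V A) = reflected_hessian k V A"
proof -
  have "transpose (reflection k V ** A + A ** reflection k V) = reflection k V ** A + A ** reflection k V"
    using matrix_transpose_mul[of "reflection k V" A] matrix_transpose_mul[of A "reflection k V"] assms
    by (simp add: transpose_reflection) (simp add: transpose_def vec_eq_iff)
  then show ?thesis
    by (simp add: reflected_hessian_def transpose_scalar)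
qed

lemma reflected_hessian_coercive:
  fixes A :: "real^'n^'n"
  assumes sym: "transpose A = A"
    and coer: "\<And>y. \<mu> * (y \<bullet> y) \<le> (reflection k v *v y) \<bullet> (A *v y)"
    and le: "\<And>y. norm (A *v y) \<le> L * norm y"
  shows "(\<mu> - 2 * spectral_norm (column_projector k V - column_projector k v) * L) * (y \<bullet> y)
    \<le> y \<bullet> (reflected_hessian k V A *v y)"
proof -
  let ?E = "column_projector k V - column_projector k v"
  \<comment> \<open>By symmetry of both factors, the two halves of the symmetrised product have the
    same quadratic form.\<close>
  have "y \<bullet> (reflected_hessian k V A *v y) = (reflection k V *v y) \<bullet> (A *v y)"
    using symmetric_inner[OF transpose_reflection, of k V y "A *v y"] symmetric_inner[OF sym, of y "reflection k V *v y"]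
    by (simp add: reflected_hessian_mult_vec inner_add_right inner_commute)
  also have "\<dots> = (reflection k v *v y) \<bullet> (A *v y) - 2 * ((?E *v y) \<bullet> (A *v y))"
    by (simp add: reflection_mult_vec matrix_vector_mult_diff_rdistrib algebra_simps inner_diff_left)
  finally have *: "y \<bullet> (reflected_hessian k V A *v y)
    = (reflection k v *v y) \<bullet> (A *v y) - 2 * ((?E *v y) \<bullet> (A *v y))" .
  have "(?E *v y) \<bullet> (A *v y) \<le> norm (?E *v y) * norm (A *v y)"
    by (rule norm_cauchy_schwarz)
  also have "\<dots> \<le> (spectral_norm ?E * norm y) * (L * norm y)"
    using norm_mult_vec_le_spectral_norm[of ?E y] le[of y] order_trans[OF norm_ge_zero]
    by (intro mult_mono) blast+
  finally show ?thesis
    using coer[of y] unfolding * by (simp add: algebra_simps dot_square_norm power2_eq_square)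
qed

text \<open>The difference is the commutator of the inexact projector with \<open>A\<close>. The
  exact projector commutes with \<open>A\<close>, so only the commutator of the error
  \<open>?E\<close> remains.\<close>

lemma reflected_hessian_deviation:
  fixes A :: "real^'n^'n"
  assumes comm: "A *v (column_projector k v *v y) = column_projector k v *v (A *v y)"
    and le: "\<And>y. norm (A *v y) \<le> L * norm y"
  shows "norm (reflected_hessian k V A *v y - reflection k V *v (A *v y))
    \<le> 2 * spectral_norm (column_projector k V - column_projector k v) * L * norm y"
proof -
  let ?E = "column_projector k V - column_projector k v"
  have d: "0 \<le> spectral_norm ?E"
    unfolding spectral_norm_def by (rule onorm_pos_le[OF matrix_vector_mul_bounded_linear])
  have L: "0 \<le> L * norm z" for z :: "real^'n"
    using le[of z] norm_ge_zero order_trans by blast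
  have "reflected_hessian k V A *v y - reflection k V *v (A *v y)
    = column_projector k V *v (A *v y) - A *v (column_projector k V *v y)"
    by (simp add: reflected_hessian_mult_vec reflection_mult_vec matrix_vector_mult_diff_distrib
        matrix_vector_mult_scaleR vec_eq_iff field_simps)
  also have "\<dots> = ?E *v (A *v y) - A *v (?E *v y)"
    using comm by (simp add: algebra_simps)
  also have "norm \<dots> \<le> norm (?E *v (A *v y)) + norm (A *v (?E *v y))"
    by (rule norm_triangle_ineq4)
  also have "\<dots> \<le> spectral_norm ?E * (L * norm y) + L * (spectral_norm ?E * norm y)"
  proof (rule add_mono)
    show "norm (?E *v (A *v y)) \<le> spectral_norm ?E * (L * norm y)"
      using norm_mult_vec_le_spectral_norm[of ?E "A *v y"] mult_left_mono[OF le d] order_trans by blast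
    show "norm (A *v (?E *v y)) \<le> L * (spectral_norm ?E * norm y)"
    \<comment> \<open>The sign of \<open>L\<close> is read off from \<open>le\<close> at a nonzero
      vector.\<close>
    proof (cases "y = 0")
      case False
      then have "0 \<le> L"
        using L[of y] by (simp add: zero_le_mult_iff)
      then show ?thesis
        using le[of "?E *v y"] mult_left_mono[OF norm_mult_vec_le_spectral_norm[of ?E y]] order_trans by blast
    qed simp
  qed
  finally show ?thesis
    by (simp add: mult_ac)
qed

section \<open>Taylor remainder and the local estimate\<close>

text \<open>Mean value inequality along the segment: \<open>\<psi>\<close> is \<open>g\<close> minus
  its linear part at \<open>x\<close>, and the norm of its derivative at \<open>t\<close> is at most
  \<open>M * (norm (z - x))\<^sup>2 * t\<close>, the derivative of \<open>\<phi>\<close>. The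
  quadratic \<open>\<phi>\<close> accounts for the factor 1/2.\<close>

lemma lipschitz_derivative_remainder:
  fixes g :: "'a::real_normed_vector \<Rightarrow> 'b::real_normed_vector"
  assumes "convex S"
    and g': "\<And>y. y \<in> S \<Longrightarrow> (g has_derivative g' y) (at y)"
    and lip: "\<And>y h. y \<in> S \<Longrightarrow> norm (g' y h - g' x h) \<le> M * norm (y - x) * norm h"
    and "x \<in> S" "z \<in> S"
  shows "norm (g z - g x - g' x (z - x)) \<le> M / 2 * (norm (z - x))\<^sup>2"
proof -
  define y where "y t = x + t *\<^sub>R (z - x)" for t
  define \<psi> where "\<psi> t = g (y t) - t *\<^sub>R g' x (z - x)" for t
  define \<phi> where "\<phi> t = M / 2 * (norm (z - x))\<^sup>2 * t\<^sup>2" for t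
  have yS: "y t \<in> S" if "t \<in> {0..1}" for t
  proof -
    have "y t = (1 - t) *\<^sub>R x + t *\<^sub>R z"
      by (simp add: y_def algebra_simps)
    with that show ?thesis
      using convexD_alt[OF assms(1,4,5)] by simp
  qed
  have y': "(y has_vector_derivative (z - x)) (at t)" for t
    unfolding y_def by (auto intro!: derivative_eq_intros)
  have \<psi>': "(\<psi> has_vector_derivative (g' (y t) (z - x) - g' x (z - x))) (at t)" if "t \<in> {0..1}" for t
  proof -
    have "((\<lambda>t. g (y t)) has_derivative (\<lambda>h. g' (y t) (h *\<^sub>R (z - x)))) (at t)"
      using has_derivative_compose[OF y'[unfolded has_vector_derivative_def] g'[OF yS[OF that]]] .
    then have "((\<lambda>t. g (y t)) has_vector_derivative g' (y t) (z - x)) (at t)"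
      using linear_scale[OF has_derivative_linear[OF g'[OF yS[OF that]]]]
      by (simp add: has_vector_derivative_def)
    then show ?thesis
      unfolding \<psi>_def by (auto intro!: derivative_eq_intros)
  qed
  have \<phi>': "(\<phi> has_vector_derivative (M * (norm (z - x))\<^sup>2 * t)) (at t)" for t
    unfolding \<phi>_def has_real_derivative_iff_has_vector_derivative[symmetric]
    by (auto intro!: derivative_eq_intros)
  have "norm (\<psi> 1 - \<psi> 0) \<le> \<phi> 1 - \<phi> 0"
  proof (rule differentiable_bound_general)
    show "continuous_on {0..1} \<psi>"
      using \<psi>' by (intro continuous_at_imp_continuous_on) (blast intro: has_vector_derivative_continuous)
    show "continuous_on {0..1} \<phi>"
      unfolding \<phi>_def by (intro continuous_intros)
    show "(\<psi> has_vector_derivative (g' (y t) (z - x) - g' x (z - x))) (at t)" if "0 < t" "t < 1" for t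
      using that by (intro \<psi>') auto
    show "(\<phi> has_vector_derivative (M * (norm (z - x))\<^sup>2 * t)) (at t)" for t
      by (rule \<phi>')
    show "norm (g' (y t) (z - x) - g' x (z - x)) \<le> M * (norm (z - x))\<^sup>2 * t" if "0 < t" "t < 1" for t
      using lip[OF yS, of t "z - x"] that by (simp add: y_def power2_eq_square mult_ac)
  qed simp
  then show ?thesis
    by (simp add: \<psi>_def \<phi>_def y_def algebra_simps)
qed

section \<open>Local error estimate for one inexact step\<close>

theorem theorem3p1:
  fixes f :: "real^'n \<Rightarrow> real"
    and k :: nat
    and xstar x s \<xi> xnext :: "real^'n"
    and v V :: "nat \<Rightarrow> real^'n"
    and H P Pt Rt Bt :: "real^'n^'n"
    and U :: "(real^'n) set"
    and r0 M L \<mu> \<sigma>min \<sigma>max \<sigma> \<eta> \<eta>bar \<delta> \<delta>bar K \<rho> r C1 C2 :: real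
  assumes "CARD('n) \<ge> 2"
    and "C_class 3 f"
    and "finite {z. gradient f z = 0 \<and> invertible (hessian f z)}"
    and "k \<le> CARD('n)"
    and "strict_critical_point k f xstar"
    and "r0 > 0" and "M > 0" and "\<mu> > 0" and "L \<ge> \<mu>"
    and "U = {y. norm (y - xstar) \<le> r0}"
    and "\<And>y z. y \<in> U \<Longrightarrow> z \<in> U \<Longrightarrow>
           spectral_norm (hessian f y - hessian f z) \<le> M * norm (y - z)"
    and "\<And>y i. y \<in> U \<Longrightarrow> i \<in> {1..k} \<Longrightarrow>
           - L \<le> ordered_eigenvalue (hessian f y) i \<and> ordered_eigenvalue (hessian f y) i \<le> - \<mu>"
    and "\<And>y i. y \<in> U \<Longrightarrow> i \<in> {k+1..CARD('n)} \<Longrightarrow>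
           \<mu> \<le> ordered_eigenvalue (hessian f y) i \<and> ordered_eigenvalue (hessian f y) i \<le> L"
    and "0 < \<sigma>min" and "\<sigma>min \<le> \<sigma>" and "\<sigma> \<le> \<sigma>max"
    and "H = hessian f x"
    and "smallest_eigenvectors k H v" and "P = column_projector k v"
    and "orthonormal_columns k V" and "Pt = column_projector k V"
    and "Rt = reflection k V"
    and "Bt = reflected_hessian k V H"
    and "\<delta> = spectral_norm (Pt - P)"
    and "\<xi> = Rt *v gradient f x + Bt *v s + (\<sigma> * norm s) *\<^sub>R s"
    and "\<eta> \<ge> 0" and "norm \<xi> \<le> \<eta> * norm (gradient f x)"
    and "xnext = x + s"
    and "\<eta>bar \<ge> 0" and "\<delta>bar \<ge> 0" and "\<delta>bar \<le> \<mu> / (4 * L)"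
    and "K = 2 * (1 + \<eta>bar) / \<mu>"
    and "\<rho> = min r0 (\<mu> / M)"
    and "r = \<rho> / (1 + K * L)"
    and "C1 = 2 * L / \<mu> * max 1 (2 * L * K)"
    and "C2 = 2 / \<mu> * (\<sigma>max + M / 2) * K\<^sup>2 * L\<^sup>2"
    and "\<delta> \<le> \<delta>bar" and "\<eta> \<le> \<eta>bar" and "norm (x - xstar) \<le> r"
  shows "{x + t *\<^sub>R s | t. t \<in> {0..1}} \<subseteq> U
    \<and> positive_semidefinite (Bt - (\<mu> / 2) *\<^sub>R mat 1)
    \<and> norm (xnext - xstar)
        \<le> C1 * (\<delta> + \<eta>) * norm (x - xstar) + C2 * (norm (x - xstar))\<^sup>2"
proof -
  have \<mu>: "\<mu> > 0" and L: "L \<ge> \<mu>" and \<eta>: "\<eta> \<ge> 0" and M: "M > 0"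
    using assms by blast+
  then have L0: "L > 0"
    by linarith
  \<comment> \<open>The bound \<open>2 \<le> K * L\<close> derived from this gives
    \<open>r \<le> \<rho>\<close> and later lets the Taylor term and the factor 2 of the commutator
    bound be absorbed into \<open>C2\<close> and \<open>C1\<close>.\<close>
  have KL: "K * L = 2 * (1 + \<eta>bar) * (L / \<mu>)"
    using assms(32) by simp
  have "1 * 1 \<le> (1 + \<eta>bar) * (L / \<mu>)"
    using \<mu> L assms(29) by (intro mult_mono) auto
  then have KL2: "2 \<le> K * L"
    unfolding KL by linarith
  then have K0: "K > 0"
    using L0 by (metis less_le_trans zero_less_mult_pos2 zero_less_numeral)
  have \<rho>: "\<rho> \<le> r0" "\<rho> > 0"
    using assms by auto
  have r1: "r * (1 + K * L) = \<rho>"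
    using KL2 assms(34) by simp
  have "r \<le> \<rho>"
  proof -
    have "r \<ge> 0"
      using assms(39) norm_ge_zero order_trans by blast
    then have "r * 1 \<le> r * (1 + K * L)"
      using KL2 by (intro mult_left_mono) auto
    with r1 show ?thesis
      by simp
  qed
  have U: "U = cball xstar r0"
    using assms(10) by (auto simp: dist_norm norm_minus_commute)
  then have convex: "convex U"
    by simp
  have xU: "x \<in> U" and sU: "xstar \<in> U"
    using assms(10,39) \<rho> \<open>r \<le> \<rho>\<close> assms(6) by auto
  have "C_class (Suc (Suc 1)) f"
    using assms(2) by (simp add: numeral_3_eq_3)
  note G = gradient_has_derivative_hessian[OF this] and sym = transpose_hessian[OF this]
  have symH: "transpose H = H"
    using sym assms(17) by simp
  have hess_le: "norm (hessian f y *v h) \<le> L * norm h" if "y \<in> U" for y h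
  proof (rule norm_mult_vec_le_ordered_eigenvalues[OF sym less_imp_le[OF L0]])
    fix i assume "i \<in> {1..CARD('n)}"
    then consider "i \<in> {1..k}" | "i \<in> {k+1..CARD('n)}"
      by fastforce
    then show "\<bar>ordered_eigenvalue (hessian f y) i\<bar> \<le> L"
      using assms(12)[OF that, of i] assms(13)[OF that, of i] \<mu> by cases auto
  qed
  then have H_le: "norm (H *v h) \<le> L * norm h" for h
    using xU assms(17) by simp
  define e where "e = x - xstar"
  define g where "g = gradient f x"
  have gstar: "gradient f xstar = 0"
    using assms(5) by (simp add: strict_critical_point_def)
  \<comment> \<open>The Hessian is bounded by \<open>L\<close> on the convex set \<open>U\<close>,
    which contains both points.\<close>
  have "norm (gradient f x - gradient f xstar) \<le> L * norm (x - xstar)"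
    by (rule differentiable_bound[OF convex has_derivative_at_withinI[OF G] _ xU sU])
      (rule onorm_le[OF hess_le])
  then have g_le: "norm g \<le> L * norm e"
    by (simp add: gstar e_def g_def)
  have "norm (hessian f y *v h - hessian f x *v h) \<le> M * norm (y - x) * norm h" if "y \<in> U" for y h
    using norm_mult_vec_le_spectral_norm[of "hessian f y - hessian f x" h]
      mult_right_mono[OF assms(11)[OF that xU], of "norm h"]
    by (simp add: matrix_vector_mult_diff_rdistrib)
  \<comment> \<open>The expansion is centred at \<open>x\<close> and evaluated at
    \<open>xstar\<close>, so that the Hessian occurring in it is \<open>H\<close>, the one from
    which \<open>Bt\<close> is built.\<close>
  note * = lipschitz_derivative_remainder[OF convex G this xU sU]
  have taylor: "norm (H *v e - g) \<le> M / 2 * (norm e)\<^sup>2"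
  proof -
    have "gradient f xstar - gradient f x - hessian f x *v (xstar - x) = H *v e - g"
      by (simp add: gstar e_def g_def assms(17) matrix_vector_mult_diff_distrib)
    then show ?thesis
      using * by (simp add: e_def norm_minus_commute)
  qed
  have \<delta>: "\<delta> = spectral_norm (column_projector k V - column_projector k v)"
    using assms(19,21,24) by simp
  \<comment> \<open>Here \<open>\<delta>bar \<le> \<mu> / (4 * L)\<close> enters: at most half of
    the coercivity constant is lost.\<close>
  have "\<mu> / 2 \<le> \<mu> - 2 * \<delta> * L"
  proof -
    have "\<delta> \<le> \<mu> / (4 * L)"
      using assms(31,37) by linarith
    with L0 show ?thesis
      by (simp add: field_simps)
  qed
  then have "\<mu> / 2 * (y \<bullet> y) \<le> (\<mu> - 2 * \<delta> * L) * (y \<bullet> y)" for y :: "real^'n"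
    by (rule mult_right_mono) simp
  moreover have "(\<mu> - 2 * \<delta> * L) * (y \<bullet> y) \<le> y \<bullet> (Bt *v y)" for y
    unfolding \<delta> assms(23)
  proof (rule reflected_hessian_coercive[OF symH _ H_le])
    show "\<mu> * (z \<bullet> z) \<le> (reflection k v *v z) \<bullet> (H *v z)" for z
      using assms(12,13)[OF xU] assms(17) by (intro reflection_coercive[OF symH assms(4,18)]) auto
  qed
  ultimately have coer: "\<mu> / 2 * (y \<bullet> y) \<le> y \<bullet> (Bt *v y)" for y
    using order_trans by blast
  have symB: "transpose Bt = Bt"
    unfolding assms(23) by (rule transpose_reflected_hessian[OF symH])
  have psd: "positive_semidefinite (Bt - (\<mu> / 2) *\<^sub>R mat 1)"
  proof -
    have "transpose (Bt - (\<mu> / 2) *\<^sub>R mat 1) = Bt - (\<mu> / 2) *\<^sub>R mat 1"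
      using symB by (auto simp: transpose_def vec_eq_iff mat_def)
    then show ?thesis
      using coer by (simp add: positive_semidefinite_def matrix_vector_mult_diff_rdistrib inner_diff_right
          scaleR_matrix_vector_assoc[symmetric])
  qed
  have Rt: "norm (Rt *v y) = norm y" for y
    unfolding assms(22) by (rule norm_reflection[OF assms(20)])
  have \<xi>: "\<xi> = Rt *v g + Bt *v s + (\<sigma> * norm s) *\<^sub>R s" and \<xi>_le: "norm \<xi> \<le> \<eta> * norm g"
    using assms(25,27) by (simp_all add: g_def)
  have \<sigma>: "\<sigma> > 0"
    using assms(14,15) by linarith

  have s_le: "norm s \<le> K * L * norm e"
  proof -
    have "\<mu> / 2 * (norm s * norm s) \<le> s \<bullet> (Bt *v s)"
      using coer[of s] by (simp add: dot_square_norm power2_eq_square)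
    \<comment> \<open>The cubic regularisation contributes \<open>\<sigma>\<close> times the cube of
      \<open>norm s\<close>, which is nonnegative and is dropped.\<close>
    also have "\<dots> \<le> s \<bullet> (\<xi> - Rt *v g)"
      using \<sigma> by (simp add: \<xi> inner_add_right)
    also have "\<dots> \<le> norm s * norm (\<xi> - Rt *v g)"
      by (rule norm_cauchy_schwarz)
    finally have "norm s * (\<mu> / 2 * norm s) \<le> norm s * norm (\<xi> - Rt *v g)"
      by (simp add: mult_ac)
    then have "\<mu> / 2 * norm s \<le> norm (\<xi> - Rt *v g)"
      by (cases "s = 0") (auto simp: mult_le_cancel_left_pos)
    also have "\<dots> \<le> \<eta> * norm g + norm g"
      using norm_triangle_ineq4[of \<xi> "Rt *v g"] \<xi>_le Rt[of g] by simp
    also have "\<dots> = (1 + \<eta>) * norm g"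
      by (simp add: algebra_simps)
    also have "\<dots> \<le> (1 + \<eta>bar) * (L * norm e)"
      using g_le assms(38) \<eta> by (intro mult_mono) auto
    finally have "norm s \<le> 2 * ((1 + \<eta>bar) * (L * norm e)) / \<mu>"
      using \<mu> by (simp add: field_simps)
    also have "2 * ((1 + \<eta>bar) * (L * norm e)) / \<mu> = K * L * norm e"
      by (simp add: assms(32) mult.assoc)
    finally show ?thesis .
  qed

  \<comment> \<open>The denominator \<open>1 + K * L\<close> in \<open>r\<close> pays for the
    initial error together with the step: their norms sum to at most
    \<open>r * (1 + K * L) = \<rho>\<close>.\<close>
  have "x + t *\<^sub>R s \<in> U" if "t \<in> {0..1}" for t
  proof -
    have "norm (x + t *\<^sub>R s - xstar) \<le> norm e + norm (t *\<^sub>R s)"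
      using norm_triangle_ineq[of e "t *\<^sub>R s"] by (simp add: e_def algebra_simps)
    also have "norm (t *\<^sub>R s) \<le> norm s"
      using that by (simp add: mult_left_le_one_le)
    also have "norm s \<le> K * L * norm e"
      by (rule s_le)
    also have "norm e + K * L * norm e = norm e * (1 + K * L)"
      by (simp add: algebra_simps)
    also have "\<dots> \<le> r * (1 + K * L)"
      using assms(39) KL2 by (intro mult_right_mono) (auto simp: e_def)
    also have "\<dots> \<le> r0"
      using r1 \<rho> by simp
    finally show ?thesis
      using assms(10) by simp
  qed
  then have segment: "{x + t *\<^sub>R s | t. t \<in> {0..1}} \<subseteq> U"
    by blast

  have dev: "norm (Bt *v e - Rt *v (H *v e)) \<le> 2 * \<delta> * L * norm e"
    unfolding \<delta> assms(22,23)
    by (rule reflected_hessian_deviation[OF column_projector_commute[OF symH assms(18)] H_le])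
  \<comment> \<open>The residual equation is solved for \<open>Bt *v s\<close>, and
    \<open>Rt *v (H *v e)\<close> is inserted with both signs. The four terms are commutator error,
    Taylor remainder, residual and regularisation.\<close>
  have "Bt *v (e + s) = (Bt *v e - Rt *v (H *v e)) + Rt *v (H *v e - g) + \<xi> - (\<sigma> * norm s) *\<^sub>R s"
    by (simp add: \<xi> matrix_vector_right_distrib matrix_vector_mult_diff_distrib)
  then have "norm (Bt *v (e + s)) \<le> norm (Bt *v e - Rt *v (H *v e)) + norm (H *v e - g) + norm \<xi> + \<sigma> * norm s * norm s"
    using norm_triangle_ineq4[of "(Bt *v e - Rt *v (H *v e)) + Rt *v (H *v e - g) + \<xi>" "(\<sigma> * norm s) *\<^sub>R s"]
      norm_triangle_ineq[of "(Bt *v e - Rt *v (H *v e)) + Rt *v (H *v e - g)" \<xi>]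
      norm_triangle_ineq[of "Bt *v e - Rt *v (H *v e)" "Rt *v (H *v e - g)"] Rt \<sigma> by simp
  moreover have "norm \<xi> \<le> \<eta> * (L * norm e)"
    using \<xi>_le mult_left_mono[OF g_le \<eta>] by linarith
  moreover have "\<sigma> * norm s * norm s \<le> \<sigma>max * (K\<^sup>2 * L\<^sup>2 * (norm e)\<^sup>2)"
  proof -
    have "norm s * norm s \<le> (K * L * norm e) * (K * L * norm e)"
      using s_le by (intro mult_mono) (auto intro: order_trans[OF norm_ge_zero])
    then have "\<sigma> * (norm s * norm s) \<le> \<sigma>max * ((K * L * norm e) * (K * L * norm e))"
      using assms(16) \<sigma> by (intro mult_mono[of \<sigma> \<sigma>max]) auto
    then show ?thesis
      by (simp add: power2_eq_square mult_ac)
  qed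
  \<comment> \<open>Enlarging by \<open>(K * L)\<^sup>2 \<ge> 1\<close> gives the Taylor term the
    same factor as the regularisation term, hence the sum \<open>\<sigma>max + M / 2\<close> in
    \<open>C2\<close>.\<close>
  moreover have "M / 2 * (norm e)\<^sup>2 \<le> M / 2 * (K\<^sup>2 * L\<^sup>2 * (norm e)\<^sup>2)"
  proof -
    have "1\<^sup>2 \<le> (K * L)\<^sup>2"
      using KL2 by (intro power_mono) auto
    then have "1 * (norm e)\<^sup>2 \<le> K\<^sup>2 * L\<^sup>2 * (norm e)\<^sup>2"
      by (intro mult_right_mono) (auto simp: power_mult_distrib)
    with M show ?thesis
      by (intro mult_left_mono) auto
  qed
  \<comment> \<open>Coercivity with Cauchy-Schwarz bounds \<open>Bt\<close> from below in norm; one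
    factor \<open>norm (e + s)\<close> cancels unless it is zero.\<close>
  moreover have "\<mu> / 2 * norm (e + s) \<le> norm (Bt *v (e + s))"
  proof -
    have "norm (e + s) * (\<mu> / 2 * norm (e + s)) \<le> norm (e + s) * norm (Bt *v (e + s))"
      using coer[of "e + s"] norm_cauchy_schwarz[of "e + s" "Bt *v (e + s)"]
      by (simp add: dot_square_norm power2_eq_square mult_ac)
    then show ?thesis
      by (cases "e + s = 0") (auto simp: mult_le_cancel_left_pos)
  qed
  ultimately have main: "\<mu> / 2 * norm (e + s)
      \<le> 2 * \<delta> * L * norm e + \<eta> * (L * norm e) + (\<sigma>max + M / 2) * (K\<^sup>2 * L\<^sup>2 * (norm e)\<^sup>2)"
    using dev taylor by (simp add: distrib_right)
  have \<delta>0: "\<delta> \<ge> 0"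
    unfolding \<delta> spectral_norm_def by (rule onorm_pos_le[OF matrix_vector_mul_bounded_linear])
  \<comment> \<open>The maximum in \<open>C1\<close> thereby covers both the coefficient 2 of
    \<open>\<delta>\<close> and the coefficient 1 of \<open>\<eta>\<close>.\<close>
  have max2: "2 \<le> max 1 (2 * L * K)"
    using KL2 by (simp add: mult_ac max_def)
  have "2 * \<delta> * L * norm e + \<eta> * (L * norm e) \<le> 2 * ((\<delta> + \<eta>) * (L * norm e))"
    using \<eta> L0 by (simp add: algebra_simps)
  also have "\<dots> \<le> max 1 (2 * L * K) * ((\<delta> + \<eta>) * (L * norm e))"
    using max2 \<eta> \<delta>0 L0 by (intro mult_right_mono) auto
  finally have "\<mu> / 2 * norm (e + s)
      \<le> max 1 (2 * L * K) * ((\<delta> + \<eta>) * (L * norm e)) + (\<sigma>max + M / 2) * (K\<^sup>2 * L\<^sup>2 * (norm e)\<^sup>2)"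
    using main by linarith
  from mult_left_mono[OF this, of "2 / \<mu>"] \<mu>
  have "norm (e + s) \<le> 2 / \<mu> * (max 1 (2 * L * K) * ((\<delta> + \<eta>) * (L * norm e))
      + (\<sigma>max + M / 2) * (K\<^sup>2 * L\<^sup>2 * (norm e)\<^sup>2))"
    by simp
  also have "\<dots> = C1 * (\<delta> + \<eta>) * norm e + C2 * (norm e)\<^sup>2"
    unfolding assms(35,36) by (simp add: algebra_simps add_divide_distrib)
  also have "e + s = xnext - xstar"
    using assms(28) by (simp add: e_def)
  finally show ?thesis
    using segment psd by (simp add: e_def)
qed

end
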